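(* Let $q\in C[0,b]$ be complex valued, let $f$ be a solution of $f''=qf$ on $[0,b]$ with $f(0)=1$ and $f\neq 0$ on $[0,b]$, and let $N\in\mathbb{N}$. Let the complex valued function $F$ be such that in a neighborhood of $x=0$ its generalized derivatives $\gamma_1(\gamma_2\gamma_1)^jF$ exist for $j=0,\ldots,N-1$ and are continuous at $x=0$. Then $$F(x)=\sum_{n=0}^{N}\alpha_n\frac{\mathbf{c}_n(x)}{n!}+o(x^N),\qquad x\to0,$$ where $\alpha_0=F(0)$ and $$\alpha_{j+1}=\gamma_1(\gamma_2\gamma_1)^jF(0)+\sum_{\text{even }n=2}^{j}\alpha_n\,\gamma_1(\gamma_2\gamma_1)^{j-n}[1](0),\qquad j=0,1,\ldots,N-1.$$ If additionally $F(0)=0$, then also $$F(x)=\sum_{n=1}^{N}\beta_n\frac{\mathbf{s}_n(x)}{n!}+o(x^N),\qquad x\to0,$$ where $$\beta_{j+1}=\gamma_1(\gamma_2\gamma_1)^jF(0)+\sum_{\text{odd }n=1}^{j}\beta_n\,\gamma_1(\gamma_2\gamma_1)^{j-n}[1](0),\qquad j=0,1,\ldots,N-1.$$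
   Context: Generalized derivatives: $\gamma_1g(x)=f^2(x)\frac{d}{dx}\left(\frac{g(x)}{f(x)}\right)$, $\gamma_2g(x)=\frac12\int_0^x\frac{g'(s)}{f(s)}ds$. The composition $\gamma_2\gamma_1$ is understood in the extended sense $\gamma_2\gamma_1g(x)=\frac12\left(g'(x)-g'(0)-\int_0^x q(s)g(s)\,ds\right)$ (which agrees with the composition for $g\in C^2$). $(\gamma_2\gamma_1)^0$ is the identity and $(\gamma_2\gamma_1)^j$ is the $j$-fold iterate; $(\gamma_2\gamma_1)^j[1]$ is its action on the constant function $1$. Neighborhoods of $0$ are relative to $[0,b]$. Empty sums are $0$. Standing regularity convention: whenever a function $(\gamma_2\gamma_1)^i[1]$ occurs in a formula, $q$ is assumed regular enough for it to be well defined ($q\in W_2^{i-1}[0,b]$ for $i\ge1$), and for $\gamma_1(\gamma_2\gamma_1)^i[1](0)$ to exist. Functions $\varphi_k$: $X^{(0)}\equiv\widetilde X^{(0)}\equiv1$, $X^{(n)}(x)=n\int_0^x X^{(n-1)}(s)\left(f^2(s)\right)^{(-1)^n}ds$, $\widetilde X^{(n)}(x)=n\int_0^x \widetilde X^{(n-1)}(s)\left(f^2(s)\right)^{(-1)^{n-1}}ds$ for $n\ge1$; $\varphi_k=fX^{(k)}$ for $k$ odd, $\varphi_k=f\widetilde X^{(k)}$ for $k$ even. Then $\mathbf{c}_0=f$, $\mathbf{s}_0\equiv0$, and for $m\ge1$, $\mathbf{c}_m(x)=\sum_{\text{even }k=0}^m\binom mk x^k\varphi_{m-k}(x)$, $\mathbf{s}_m(x)=\sum_{\text{odd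 }k=1}^m\binom mk x^k\varphi_{m-k}(x)$. *)

theory Defs
  imports "HOL-Analysis.Analysis" "HOL-Library.Landau_Symbols"
begin

text \<open>
  Functions on \<open>[0,b]\<close> are total functions \<open>real \<Rightarrow> complex\<close> of which only the values on
  \<open>{0..b}\<close> (or on a relative neighbourhood of \<open>0\<close> in it) matter; all derivatives are taken within
  \<open>{0..b}\<close>, hence are one-sided at the endpoints.
\<close>

definition schroedinger_solution ::
    "(real \<Rightarrow> complex) \<Rightarrow> real \<Rightarrow> (real \<Rightarrow> complex) \<Rightarrow> bool" where
  "schroedinger_solution q b f \<longleftrightarrow>
     (\<exists>f'. \<forall>x\<in>{0..b}.
        (f has_vector_derivative f' x) (at x within {0..b}) \<and>
        (f' has_vector_derivative q x * f x) (at x within {0..b}))"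

definition gamma1_exists ::
    "(real \<Rightarrow> complex) \<Rightarrow> real \<Rightarrow> (real \<Rightarrow> complex) \<Rightarrow> real \<Rightarrow> bool" where
  "gamma1_exists f b g x \<longleftrightarrow> (\<lambda>t. g t / f t) differentiable (at x within {0..b})"

definition gamma1 ::
    "(real \<Rightarrow> complex) \<Rightarrow> real \<Rightarrow> (real \<Rightarrow> complex) \<Rightarrow> real \<Rightarrow> complex" where
  "gamma1 f b g x = (f x)\<^sup>2 * vector_derivative (\<lambda>t. g t / f t) (at x within {0..b})"

text \<open>
  The composition \<open>\<gamma>\<^sub>2\<gamma>\<^sub>1\<close>, where \<open>\<gamma>\<^sub>2 g x = (1/2) \<integral>\<^sub>0\<^sup>x g'(s) / f(s) ds\<close>, in the extended sense that
  requires \<open>g\<close> to be differentiable only once. For \<open>g\<close> twice continuously differentiable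
  one has \<open>\<gamma>\<^sub>1 g = f g' - f' g\<close>, so \<open>(\<gamma>\<^sub>1 g)' / f = g'' - q g\<close>, and this is the literal composition.
\<close>
definition gamma21 ::
    "(real \<Rightarrow> complex) \<Rightarrow> real \<Rightarrow> (real \<Rightarrow> complex) \<Rightarrow> real \<Rightarrow> complex" where
  "gamma21 q b g x =
     (vector_derivative g (at x within {0..b}) - vector_derivative g (at 0 within {0..b})
        - integral {0..x} (\<lambda>s. q s * g s)) / 2"

text \<open>
  The Sobolev space \<open>W\<^sub>2\<^sup>k[0,b]\<close>, through the characterisation of \<open>W\<^sub>2\<^sup>k\<^sup>+\<^sup>1\<close> in one variable: absolutely
  continuous functions with derivative in \<open>W\<^sub>2\<^sup>k\<close>. For positive order the predicate selects the
  continuous representative.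
\<close>
primrec sobolev2 :: "real \<Rightarrow> nat \<Rightarrow> (real \<Rightarrow> complex) \<Rightarrow> bool" where
  "sobolev2 b 0 g \<longleftrightarrow>
     g \<in> borel_measurable (lebesgue_on {0..b}) \<and>
     integrable (lebesgue_on {0..b}) (\<lambda>x. (cmod (g x))\<^sup>2)"
| "sobolev2 b (Suc k) g \<longleftrightarrow>
     (\<exists>h. sobolev2 b k h \<and> (\<forall>x\<in>{0..b}. g x = g 0 + integral {0..x} h))"

text \<open>
  The standing regularity convention for an occurrence of \<open>\<gamma>\<^sub>1(\<gamma>\<^sub>2\<gamma>\<^sub>1)\<^sup>i[1](0)\<close>: \<open>q\<close> lies in \<open>W\<^sub>2\<^sup>i\<^sup>-\<^sup>1[0,b]\<close>
  if \<open>i \<ge> 1\<close>, and the outer \<open>\<gamma>\<^sub>1\<close> exists at \<open>0\<close>.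
\<close>
definition regular_for ::
    "(real \<Rightarrow> complex) \<Rightarrow> (real \<Rightarrow> complex) \<Rightarrow> real \<Rightarrow> nat \<Rightarrow> bool" where
  "regular_for q f b i \<longleftrightarrow>
     (i \<ge> 1 \<longrightarrow> sobolev2 b (i - 1) q) \<and>
     gamma1_exists f b ((gamma21 q b ^^ i) (\<lambda>_. 1)) 0"

primrec X_fun :: "(real \<Rightarrow> complex) \<Rightarrow> nat \<Rightarrow> real \<Rightarrow> complex" where
  "X_fun f 0 = (\<lambda>x. 1)"
| "X_fun f (Suc n) =
     (\<lambda>x. of_nat (Suc n) * integral {0..x} (\<lambda>s. X_fun f n s * ((f s)\<^sup>2) powi ((-1) ^ Suc n)))"

primrec Xt_fun :: "(real \<Rightarrow> complex) \<Rightarrow> nat \<Rightarrow> real \<Rightarrow> complex" where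
  "Xt_fun f 0 = (\<lambda>x. 1)"
| "Xt_fun f (Suc n) =
     (\<lambda>x. of_nat (Suc n) * integral {0..x} (\<lambda>s. Xt_fun f n s * ((f s)\<^sup>2) powi ((-1) ^ n)))"

definition phi_fun :: "(real \<Rightarrow> complex) \<Rightarrow> nat \<Rightarrow> real \<Rightarrow> complex" where
  "phi_fun f k x = (if odd k then f x * X_fun f k x else f x * Xt_fun f k x)"

definition c_fun :: "(real \<Rightarrow> complex) \<Rightarrow> nat \<Rightarrow> real \<Rightarrow> complex" where
  "c_fun f m x =
     (\<Sum>k\<in>{k\<in>{0..m}. even k}. of_nat (m choose k) * of_real x ^ k * phi_fun f (m - k) x)"

definition s_fun :: "(real \<Rightarrow> complex) \<Rightarrow> nat \<Rightarrow> real \<Rightarrow> complex" where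
  "s_fun f m x =
     (\<Sum>k\<in>{k\<in>{1..m}. odd k}. of_nat (m choose k) * of_real x ^ k * phi_fun f (m - k) x)"

text \<open>The values at index \<open>0\<close>, which are usually prescribed separately, come out of the sums.\<close>

lemma c_fun_0: "c_fun f 0 = f"
proof -
  have "{k\<in>{0..0::nat}. even k} = {0}" by auto
  then show ?thesis by (simp add: c_fun_def phi_fun_def fun_eq_iff)
qed

lemma s_fun_0: "s_fun f 0 = (\<lambda>x. 0)"
  by (simp add: s_fun_def fun_eq_iff)

end

theory Submission
  imports Defs
begin

text \<open>
  Write \<open>D = \<gamma>\<^sub>2\<gamma>\<^sub>1\<close>, so that \<open>g' = g'(0) + \<integral>\<^sub>0\<^sup>x q g + 2 D g\<close>.

  The functions \<open>c\<^sub>m\<close> and \<open>s\<^sub>m\<close> are the values on the diagonal \<open>t = x\<close> of the polynomials in \<open>t\<close>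
  given by \<open>u(x,t) = \<Sum> (m choose k) t\<^sup>k \<phi>\<^sub>m\<^sub>-\<^sub>k(x)\<close>, where \<open>k\<close> runs over the even or over the odd
  numbers. These solve the wave equation \<open>u\<^sub>x\<^sub>x - q u = u\<^sub>t\<^sub>t\<close>; hence \<open>v(x) = u(x,x)\<close> satisfies
  \<open>v'' - q v = 2 (u\<^sub>t(x,x))'\<close>, that is, \<open>D v\<close> is the trace of \<open>u\<^sub>t\<close> minus its value at \<open>0\<close>. Since
  differentiation in \<open>t\<close> lowers \<open>m\<close> and exchanges the parities, \<open>D\<close> maps \<open>c\<^sub>m/m!\<close> to
  \<open>s\<^sub>m\<^sub>-\<^sub>1/(m-1)!\<close> and \<open>s\<^sub>m/m!\<close> to \<open>c\<^sub>m\<^sub>-\<^sub>1/(m-1)!\<close>, except that \<open>D s\<^sub>1 = c\<^sub>0 - 1\<close>; also \<open>D c\<^sub>0 = 0\<close>.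
  So \<open>D\<^sup>j\<close> of a trace of index \<open>n\<close> is a trace of index \<open>n - j\<close> as long as \<open>j < n\<close>, and afterwards
  all that can remain is \<open>-D\<^sup>j\<^sup>-\<^sup>n[1]\<close> (next to \<open>c\<^sub>0 = f\<close> when \<open>j = n\<close>, which \<open>\<gamma>\<^sub>1\<close> kills). This is
  where the correction sums in the recursion for the coefficients come from
  (\<open>gamma21_rel_wave_trace\<close>, \<open>gamma21_rel_trace_chain\<close>).

  At \<open>0\<close> the generalized derivative \<open>\<gamma>\<^sub>1\<close> of a trace of index \<open>m\<close> is \<open>1\<close> if \<open>m = 1\<close> and \<open>0\<close>
  otherwise. The recursion therefore says precisely that the remainder, \<open>R = F - \<Sum> \<alpha>\<^sub>n c\<^sub>n/n!\<close> in
  the first and \<open>R = F - \<Sum> \<beta>\<^sub>n s\<^sub>n/n!\<close> in the second expansion, satisfies \<open>R(0) = 0\<close> and \<open>\<gamma>\<^sub>1 D\<^sup>j R(0) = 0\<close> for \<open>j < N\<close>, and since \<open>D\<^sup>j R(0) = 0\<close>, also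
  \<open>(D\<^sup>j R)'(0) = 0\<close>. Now \<open>D\<^sup>N\<^sup>-\<^sup>1 R = o(x)\<close> by the definition of the derivative, and
  every step from \<open>D g\<close> back to \<open>g\<close> gains one order: \<open>g' = \<integral>\<^sub>0\<^sup>x q g + o(x\<^sup>m)\<close> with \<open>g(0) = 0\<close> forces
  \<open>g = o(x\<^sup>m\<^sup>+\<^sup>1)\<close> (\<open>smallo_gamma21_lift\<close>). After \<open>N - 1\<close> steps, \<open>R = o(x\<^sup>N)\<close>.

  The functions \<open>D\<^sup>i[1]\<close> that occur must be differentiable near \<open>0\<close> for \<open>D\<close> to act on them and to be
  additive there. A function \<open>q \<in> W\<^sub>2\<^sup>i\<close> with \<open>i \<ge> 1\<close> is of class \<open>C\<^sup>i\<^sup>-\<^sup>1\<close>; then \<open>D[1] = -\<integral>q/2\<close> is of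
  class \<open>C\<^sup>i\<close>, and each further application of \<open>D\<close> costs one derivative
  (\<open>gamma21_iterate_one_differentiable\<close>).
\<close>

section \<open>The operator \<open>\<gamma>\<^sub>2\<gamma>\<^sub>1\<close> and orders of vanishing at 0\<close>

text \<open>
  The relation \<open>k = \<gamma>\<^sub>2\<gamma>\<^sub>1 g\<close> on \<open>[0,d]\<close>, including the differentiability of \<open>g\<close> there. In contrast
  to the function \<open>gamma21\<close>, whose values at points without a derivative are arbitrary, it is
  linear in the pair \<open>(g,k)\<close>, and it can be used on a short interval \<open>[0,d] \<subseteq> [0,b]\<close> on which
  \<open>F\<close> is known to be regular.
\<close>
definition gamma21_rel :: "(real \<Rightarrow> complex) \<Rightarrow> real \<Rightarrow> (real \<Rightarrow> complex) \<Rightarrow> (real \<Rightarrow> complex) \<Rightarrow> bool"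
  where "gamma21_rel q d g k \<longleftrightarrow>
     (\<exists>g'. \<forall>x\<in>{0..d}. (g has_vector_derivative g' x) (at x within {0..d}) \<and>
            k x = (g' x - g' 0 - integral {0..x} (\<lambda>s. q s * g s)) / 2)"

lemma gamma21_rel_gamma21:
  assumes "0 < d" "d \<le> b"
    and "\<And>x. x \<in> {0..d} \<Longrightarrow> g differentiable (at x within {0..b})"
  shows "gamma21_rel q d g (gamma21 q b g)"
  unfolding gamma21_rel_def
proof (intro exI ballI conjI)
  fix x assume x: "x \<in> {0..d}"
  have "(g has_vector_derivative vector_derivative g (at x within {0..b})) (at x within {0..b})"
    using assms(3)[OF x] vector_derivative_works by blast
  then show "(g has_vector_derivative vector_derivative g (at x within {0..b})) (at x within {0..d})"
    by (rule has_vector_derivative_within_subset) (use assms in auto)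
qed (simp add: gamma21_def)

lemma gamma21_rel_at_0: "gamma21_rel q d g k \<Longrightarrow> 0 \<le> d \<Longrightarrow> k 0 = 0"
  unfolding gamma21_rel_def by (auto dest: bspec[of _ _ 0])

lemma gamma21_rel_continuous: "gamma21_rel q d g k \<Longrightarrow> continuous_on {0..d} g"
  unfolding gamma21_rel_def continuous_on_eq_continuous_within
  by (meson has_vector_derivative_continuous)

lemma gamma21_rel_integrable:
  assumes "gamma21_rel q d g k" "continuous_on {0..d} q" "x \<in> {0..d}"
  shows "(\<lambda>s. q s * g s) integrable_on {0..x}"
proof (rule integrable_continuous_real)
  show "continuous_on {0..x} (\<lambda>s. q s * g s)"
    by (rule continuous_on_subset[of "{0..d}"])
       (use assms gamma21_rel_continuous in \<open>auto intro!: continuous_on_mult\<close>)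
qed

lemma gamma21_rel_lincomb:
  assumes "continuous_on {0..d} q" "gamma21_rel q d g k" "gamma21_rel q d h l"
  shows "gamma21_rel q d (\<lambda>x. g x + c * h x) (\<lambda>x. k x + c * l x)"
proof -
  obtain g' where g': "\<And>x. x \<in> {0..d} \<Longrightarrow> (g has_vector_derivative g' x) (at x within {0..d})"
      "\<And>x. x \<in> {0..d} \<Longrightarrow> k x = (g' x - g' 0 - integral {0..x} (\<lambda>s. q s * g s)) / 2"
    using assms(2) unfolding gamma21_rel_def by blast
  obtain h' where h': "\<And>x. x \<in> {0..d} \<Longrightarrow> (h has_vector_derivative h' x) (at x within {0..d})"
      "\<And>x. x \<in> {0..d} \<Longrightarrow> l x = (h' x - h' 0 - integral {0..x} (\<lambda>s. q s * h s)) / 2"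
    using assms(3) unfolding gamma21_rel_def by blast
  show ?thesis
    unfolding gamma21_rel_def
  proof (intro exI ballI conjI)
    fix x assume x: "x \<in> {0..d}"
    show "((\<lambda>x. g x + c * h x) has_vector_derivative g' x + c * h' x) (at x within {0..d})"
      using g'(1)[OF x] h'(1)[OF x] by (auto intro!: derivative_eq_intros)
    have "integral {0..x} (\<lambda>s. q s * (g s + c * h s))
        = integral {0..x} (\<lambda>s. q s * g s + c * (q s * h s))"
      by (simp add: algebra_simps)
    also have "\<dots> = integral {0..x} (\<lambda>s. q s * g s) + c * integral {0..x} (\<lambda>s. q s * h s)"
      using gamma21_rel_integrable[OF assms(2,1) x] gamma21_rel_integrable[OF assms(3,1) x]
      by (subst integral_add) (auto intro: integrable_on_mult_right)
    finally show "k x + c * l x = (g' x + c * h' x - (g' 0 + c * h' 0)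
        - integral {0..x} (\<lambda>s. q s * (g s + c * h s))) / 2"
      unfolding g'(2)[OF x] h'(2)[OF x] by (simp add: field_simps)
  qed
qed

lemma gamma21_rel_zero: "gamma21_rel q d (\<lambda>x. 0) (\<lambda>x. 0)"
  unfolding gamma21_rel_def by (rule exI[of _ "\<lambda>x. 0"]) auto

lemma gamma21_rel_sum:
  assumes "continuous_on {0..d} q" "gamma21_rel q d g k"
    and "finite A" "\<And>n. n \<in> A \<Longrightarrow> gamma21_rel q d (h n) (l n)"
  shows "gamma21_rel q d (\<lambda>x. g x - (\<Sum>n\<in>A. c n * h n x)) (\<lambda>x. k x - (\<Sum>n\<in>A. c n * l n x))"
  using assms(3,4)
proof (induction A rule: finite_induct)
  case empty
  then show ?case using assms(2) by simp
next
  case (insert a A)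
  have "gamma21_rel q d (\<lambda>x. (g x - (\<Sum>n\<in>A. c n * h n x)) + (- c a) * h a x)
          (\<lambda>x. (k x - (\<Sum>n\<in>A. c n * l n x)) + (- c a) * l a x)"
    by (rule gamma21_rel_lincomb) (use insert assms(1) in auto)
  then show ?case using insert(1,2) by (simp add: algebra_simps)
qed

text \<open>
  A Gronwall-type estimate. Here \<open>g' = \<integral>\<^sub>0\<^sup>x q g + 2 k\<close>, because \<open>g'(0) = 0\<close>. If \<open>M\<close> is the maximum
  of \<open>|g|\<close> on \<open>[0,x]\<close> and \<open>|q| \<le> K\<close>, then on \<open>[0,x]\<close> one has
  \<open>|g'| \<le> K M x + c x\<^sup>m / 2\<close>, so \<open>M \<le> K x\<^sup>2 M + c x\<^sup>m\<^sup>+\<^sup>1 / 2\<close>. For small \<open>x\<close> the first term is at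
  most \<open>M/2\<close> and can be absorbed.
\<close>
lemma smallo_gamma21_lift:
  assumes "0 < d" "continuous_on {0..d} q" "gamma21_rel q d g k"
    and "g 0 = 0" and "(g has_vector_derivative 0) (at 0 within {0..d})"
    and small: "k \<in> o[at_right 0](\<lambda>x. of_real x ^ m)"
  shows "g \<in> o[at_right 0](\<lambda>x. of_real x ^ Suc m)"
proof (rule landau_o.smallI)
  fix c :: real assume c: "c > 0"
  obtain g' where g': "\<And>x. x \<in> {0..d} \<Longrightarrow> (g has_vector_derivative g' x) (at x within {0..d})"
      "\<And>x. x \<in> {0..d} \<Longrightarrow> k x = (g' x - g' 0 - integral {0..x} (\<lambda>s. q s * g s)) / 2"
    using assms(3) unfolding gamma21_rel_def by blast
  have g'0: "g' 0 = 0"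
    using vector_derivative_unique_within_closed_interval[of 0 d 0 g "g' 0" 0] assms(1,5) g'(1)[of 0]
    by auto
  obtain K where K: "K > 0" "\<And>x. x \<in> {0..d} \<Longrightarrow> norm (q x) \<le> K"
  proof -
    have "compact (q ` {0..d})" using assms(2) by (intro compact_continuous_image) auto
    then have "bounded (q ` {0..d})" by (rule compact_imp_bounded)
    then show ?thesis using that unfolding bounded_pos by auto
  qed
  have "eventually (\<lambda>x. norm (k x) \<le> c / 4 * norm (of_real x ^ m :: complex)) (at_right 0)"
    using landau_o.smallD[OF small, of "c/4"] c by simp
  then obtain r where r: "r > 0" "\<And>x. 0 < x \<Longrightarrow> x < r \<Longrightarrow> norm (k x) \<le> c / 4 * x ^ m"
    unfolding eventually_at_right_field by (auto simp: norm_power)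
  \<comment> \<open>the last two bounds give \<open>K x\<^sup>2 \<le> 1/2\<close> for \<open>x < r'\<close>\<close>
  define r' where "r' = Min {r, d, 1 / (2 * K + 1), 1}"
  have r': "r' > 0" "r' \<le> r" "r' \<le> d" "r' \<le> 1 / (2 * K + 1)" "r' \<le> 1"
    unfolding r'_def using r assms(1) K by (auto simp: min_le_iff_disj)
  have bound: "norm (g x) \<le> c * x ^ Suc m" if x: "0 < x" "x < r'" for x
  proof -
    have xd: "x \<le> d" "x < r" using x r' by auto
    have cont: "continuous_on {0..x} g"
      using gamma21_rel_continuous[OF assms(3)] xd by (auto intro: continuous_on_subset)
    then have "continuous_on {0..x} (\<lambda>t. norm (g t))" by (intro continuous_on_norm)
    then obtain t0 where t0: "t0 \<in> {0..x}" "\<And>t. t \<in> {0..x} \<Longrightarrow> norm (g t) \<le> norm (g t0)"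
      using continuous_attains_sup[of "{0..x}" "\<lambda>t. norm (g t)"] x by auto
    define M where "M = norm (g t0)"
    have M: "M \<ge> 0" "\<And>t. t \<in> {0..x} \<Longrightarrow> norm (g t) \<le> M" using t0 by (auto simp: M_def)
    have g'_bound: "norm (g' t) \<le> K * M * x + c / 2 * x ^ m" if t: "t \<in> {0..x}" for t
    proof -
      have td: "t \<in> {0..d}" using t xd by auto
      have "g' t = 2 * k t + integral {0..t} (\<lambda>s. q s * g s)"
        using g'(2)[OF td] g'0 by (simp add: field_simps)
      then have "norm (g' t) \<le> 2 * norm (k t) + norm (integral {0..t} (\<lambda>s. q s * g s))"
        using norm_triangle_ineq[of "2 * k t" "integral {0..t} (\<lambda>s. q s * g s)"]
        by (simp add: norm_mult)
      moreover have "norm (integral {0..t} (\<lambda>s. q s * g s)) \<le> (K * M) * (t - 0)"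
      proof (rule integral_bound)
        show "continuous_on {0..t} (\<lambda>s. q s * g s)"
          by (rule continuous_on_subset[of "{0..d}"])
             (use td assms(2) gamma21_rel_continuous[OF assms(3)] in \<open>auto intro!: continuous_on_mult\<close>)
        fix s assume "s \<in> {0..t}"
        then show "norm (q s * g s) \<le> K * M"
          using K(2)[of s] M t td K(1) by (auto simp: norm_mult intro!: mult_mono)
      qed (use t in auto)
      moreover have "(K * M) * (t - 0) \<le> K * M * x"
        using t K M by (intro mult_left_mono) auto
      moreover have "2 * norm (k t) \<le> c / 2 * x ^ m"
      proof (cases "t = 0")
        case True
        have "k 0 = 0" using gamma21_rel_at_0[OF assms(3)] assms(1) by simp
        then show ?thesis using True c x by simp
      next
        case False
        then have "norm (k t) \<le> c / 4 * t ^ m" using r(2)[of t] t xd by auto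
        also have "\<dots> \<le> c / 4 * x ^ m" using t c by (intro mult_left_mono power_mono) auto
        finally show ?thesis by simp
      qed
      ultimately show ?thesis by linarith
    qed
    have "norm (g t0 - g 0) \<le> (K * M * x + c / 2 * x ^ m) * norm (t0 - 0)"
    proof (rule differentiable_bound[where S = "{0..x}" and f' = "\<lambda>t h. h *\<^sub>R g' t"])
      fix t assume t: "t \<in> {0..x}"
      show "(g has_derivative (\<lambda>h. h *\<^sub>R g' t)) (at t within {0..x})"
        using has_vector_derivative_within_subset[OF g'(1)[of t], of "{0..x}"] t xd
        by (auto simp: has_vector_derivative_def)
      show "onorm (\<lambda>h. h *\<^sub>R g' t) \<le> K * M * x + c / 2 * x ^ m"
        by (rule onorm_bound)
           (use g'_bound[OF t] order_trans[OF norm_ge_zero g'_bound[OF t]] in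
             \<open>auto simp: mult.commute[of "\<bar>_\<bar>"] intro!: mult_right_mono\<close>)
    qed (use t0 x in auto)
    also have "\<dots> \<le> (K * M * x + c / 2 * x ^ m) * x"
      using t0 K M c x by (intro mult_left_mono) auto
    finally have "M \<le> (K * M * x + c / 2 * x ^ m) * x" by (simp add: M_def assms(4))
    also have "\<dots> = M * (K * x * x) + c / 2 * x ^ Suc m" by (simp add: algebra_simps)
    also have "M * (K * x * x) \<le> M * (1 / 2)"
    proof (rule mult_left_mono)
      have "x \<le> 1 / (2 * K + 1)" using x r'(4) by simp
      then have "x * (2 * K + 1) \<le> 1" using K(1) by (simp add: pos_le_divide_eq)
      then have "K * x \<le> 1 / 2" using x by (simp add: algebra_simps)
      then show "K * x * x \<le> 1 / 2" using x r'(5) mult_mono[of "K * x" "1/2" x 1] by simp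
    qed (use M in auto)
    finally have "M \<le> c * x ^ Suc m" by simp
    then show ?thesis using M(2)[of x] x by auto
  qed
  show "\<forall>\<^sub>F x in at_right 0. norm (g x) \<le> c * norm (of_real x ^ Suc m :: complex)"
    unfolding eventually_at_right_field
    by (rule exI[of _ r']) (use bound r' in \<open>auto simp: norm_power norm_mult\<close>)
qed

text \<open>
  One order comes from the vanishing derivative of the last function, and one from each
  of the \<open>M\<close> steps back to \<open>G 0\<close>. Only the first value \<open>G 0 0\<close> has to be prescribed, since
  \<open>\<gamma>\<^sub>2\<gamma>\<^sub>1 g\<close> always vanishes at \<open>0\<close>.
\<close>
lemma smallo_gamma21_chain:
  assumes "0 < d" "continuous_on {0..d} q"
    and "\<And>j. j < M \<Longrightarrow> gamma21_rel q d (G j) (G (Suc j))"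
    and "\<And>j. j \<le> M \<Longrightarrow> (G j has_vector_derivative 0) (at 0 within {0..d})"
    and "G 0 0 = 0"
  shows "G 0 \<in> o[at_right 0](\<lambda>x. of_real x ^ Suc M)"
  using assms(3-5)
proof (induction M arbitrary: G)
  case 0
  have "(G 0 has_derivative (\<lambda>h. 0)) (at_right 0)"
    using 0(2)[of 0] assms(1) by (simp add: has_vector_derivative_def at_within_Icc_at_right)
  then have "((\<lambda>y. norm (G 0 y - G 0 0 - 0) / norm (y - 0)) \<longlongrightarrow> 0) (at_right 0)"
    unfolding has_derivative_iff_norm by simp
  then have "((\<lambda>y. norm (G 0 y / of_real y ^ Suc 0)) \<longlongrightarrow> 0) (at_right 0)"
    by (simp add: 0(3) norm_divide)
  then have "((\<lambda>y. G 0 y / of_real y ^ Suc 0) \<longlongrightarrow> 0) (at_right 0)"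
    by (rule tendsto_norm_zero_cancel)
  then show ?case
    by (intro smalloI_tendsto) (auto simp: eventually_at_filter)
next
  case (Suc M)
  have "G 1 0 = 0" using gamma21_rel_at_0[OF Suc.prems(1)[of 0]] assms(1) by simp
  then have "G (Suc 0) \<in> o[at_right 0](\<lambda>x. of_real x ^ Suc M)"
    using Suc.IH[of "\<lambda>j. G (Suc j)"] Suc.prems by auto
  then show ?case
    by (intro smallo_gamma21_lift[OF assms(1,2) Suc.prems(1)[of 0] Suc.prems(3) Suc.prems(2)]) auto
qed

section \<open>Smoothness of the iterates \<open>(\<gamma>\<^sub>2\<gamma>\<^sub>1)\<^sup>i[1]\<close>\<close>

primrec C_diff :: "real \<Rightarrow> nat \<Rightarrow> (real \<Rightarrow> complex) \<Rightarrow> bool" where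
  "C_diff b 0 g \<longleftrightarrow> continuous_on {0..b} g"
| "C_diff b (Suc k) g \<longleftrightarrow>
     (\<exists>h. C_diff b k h \<and> (\<forall>x\<in>{0..b}. (g has_vector_derivative h x) (at x within {0..b})))"

lemma C_diff_cong:
  assumes "C_diff b k g" "\<And>x. x \<in> {0..b} \<Longrightarrow> g x = h x"
  shows "C_diff b k h"
proof (cases k)
  case 0
  then show ?thesis using assms continuous_on_cong[of "{0..b}" "{0..b}" g h] by auto
next
  case (Suc k')
  then obtain g' where g': "C_diff b k' g'"
    "\<And>x. x \<in> {0..b} \<Longrightarrow> (g has_vector_derivative g' x) (at x within {0..b})"
    using assms by auto
  have "(h has_vector_derivative g' x) (at x within {0..b})" if "x \<in> {0..b}" for x
    using has_vector_derivative_transform[OF that, of h g] g'(2)[OF that] assms(2) by auto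
  then show ?thesis using Suc g' by auto
qed

lemma C_diff_Suc_D: "C_diff b (Suc k) g \<Longrightarrow> C_diff b k g"
proof (induction k arbitrary: g)
  case 0
  then show ?case
    by (auto simp: continuous_on_eq_continuous_within intro: has_vector_derivative_continuous)
next
  case (Suc k)
  then obtain h where h: "C_diff b (Suc k) h"
    "\<forall>x\<in>{0..b}. (g has_vector_derivative h x) (at x within {0..b})" by (auto simp only: C_diff.simps)
  with Suc.IH show ?case by (subst C_diff.simps) blast
qed

lemma C_diff_mono: "C_diff b k g \<Longrightarrow> m \<le> k \<Longrightarrow> C_diff b m g"
  by (induction k) (auto simp del: C_diff.simps simp: le_Suc_eq dest: C_diff_Suc_D)

lemma C_diff_lincomb: "C_diff b k g \<Longrightarrow> C_diff b k h \<Longrightarrow> C_diff b k (\<lambda>x. g x + c * h x)"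
proof (induction k arbitrary: g h)
  case 0
  then show ?case by (auto intro!: continuous_intros)
next
  case (Suc k)
  then obtain g' h' where "C_diff b k g'" "C_diff b k h'"
    "\<forall>x\<in>{0..b}. (g has_vector_derivative g' x) (at x within {0..b})"
    "\<forall>x\<in>{0..b}. (h has_vector_derivative h' x) (at x within {0..b})" by auto
  with Suc.IH[of g' h'] show ?case
    by (auto intro!: exI[of _ "\<lambda>x. g' x + c * h' x"] derivative_eq_intros)
qed

lemma C_diff_mult: "C_diff b k g \<Longrightarrow> C_diff b k h \<Longrightarrow> C_diff b k (\<lambda>x. g x * h x)"
proof (induction k arbitrary: g h)
  case 0
  then show ?case by (auto intro!: continuous_intros)
next
  case (Suc k)
  then obtain g' h' where d: "C_diff b k g'" "C_diff b k h'"
    "\<forall>x\<in>{0..b}. (g has_vector_derivative g' x) (at x within {0..b})"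
    "\<forall>x\<in>{0..b}. (h has_vector_derivative h' x) (at x within {0..b})" by auto
  have "C_diff b k (\<lambda>x. g x * h' x + 1 * (g' x * h x))"
    by (intro C_diff_lincomb Suc.IH d C_diff_Suc_D[OF Suc.prems(1)] C_diff_Suc_D[OF Suc.prems(2)])
  moreover have "((\<lambda>x. g x * h x) has_vector_derivative g x * h' x + 1 * (g' x * h x))
      (at x within {0..b})" if "x \<in> {0..b}" for x
    using has_vector_derivative_mult d(3,4) that by fastforce
  ultimately show ?case by auto
qed

lemma C_diff_const: "C_diff b k (\<lambda>x. c)"
proof (induction k arbitrary: c)
  case (Suc k)
  then show ?case by (auto intro!: exI[of _ "\<lambda>x. 0"])
qed auto

lemma C_diff_integral:
  assumes "C_diff b k g"
  shows "C_diff b (Suc k) (\<lambda>x. integral {0..x} g)"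
proof -
  have "continuous_on {0..b} g" using C_diff_mono[OF assms, of 0] by simp
  then show ?thesis using assms integral_has_vector_derivative[of 0 b g] by auto
qed

text \<open>
  By \<open>|g| \<le> 1 + |g|\<^sup>2\<close>, and constants are integrable on a set of finite measure.
\<close>
lemma sobolev2_0_integrable:
  assumes "sobolev2 b 0 g"
  shows "g integrable_on {0..b}"
proof -
  have m: "g \<in> borel_measurable (lebesgue_on {0..b})"
    and i: "integrable (lebesgue_on {0..b}) (\<lambda>x. (cmod (g x))\<^sup>2)"
    using assms by auto
  have "integrable (lebesgue_on {0..b}) (\<lambda>x. 1 + (cmod (g x))\<^sup>2)"
    using i by (intro Bochner_Integration.integrable_add)
       (auto intro!: finite_measure.integrable_const finite_measure_lebesgue_on)
  then have "integrable (lebesgue_on {0..b}) g"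
  proof (rule Bochner_Integration.integrable_bound[OF _ m])
    have "cmod (g x) \<le> norm (1 + (cmod (g x))\<^sup>2)" for x
      using zero_le_power2[of "cmod (g x) - 1"] norm_ge_zero[of "g x"]
      by (simp add: power2_diff) (smt (verit) zero_le_power2)
    then show "AE x in lebesgue_on {0..b}. cmod (g x) \<le> norm (1 + (cmod (g x))\<^sup>2)" by simp
  qed
  then show ?thesis
    by (intro integrable_on_lebesgue_on) auto
qed

text \<open>
  At the lowest order this is the continuity of an indefinite integral; each further
  integration raises both indices by one.
\<close>
lemma sobolev2_imp_C_diff: "sobolev2 b (Suc k) g \<Longrightarrow> C_diff b k g"
proof (induction k arbitrary: g)
  case 0
  then obtain h where h: "sobolev2 b 0 h" "\<And>x. x \<in> {0..b} \<Longrightarrow> g x = g 0 + integral {0..x} h"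
    unfolding sobolev2.simps by blast
  have "continuous_on {0..b} (\<lambda>x. g 0 + integral {0..x} h)"
    using indefinite_integral_continuous_1[OF sobolev2_0_integrable[OF h(1)]]
    by (intro continuous_on_add) auto
  then have "C_diff b 0 (\<lambda>x. g 0 + integral {0..x} h)" by simp
  then show ?case by (rule C_diff_cong) (use h(2) in metis)
next
  case (Suc k)
  then obtain h where h: "sobolev2 b (Suc k) h" "\<And>x. x \<in> {0..b} \<Longrightarrow> g x = g 0 + integral {0..x} h"
    unfolding sobolev2.simps by blast
  have "C_diff b (Suc k) (\<lambda>x. g 0 + 1 * integral {0..x} h)"
    by (intro C_diff_lincomb C_diff_const C_diff_integral Suc.IH h(1))
  then show ?case by (rule C_diff_cong) (use h(2) in \<open>metis mult_1\<close>)
qed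

lemma C_diff_gamma21:
  assumes "b > 0" "C_diff b k q" "C_diff b (Suc k) g"
  shows "C_diff b k (gamma21 q b g)"
proof -
  obtain g' where g': "C_diff b k g'"
    "\<And>x. x \<in> {0..b} \<Longrightarrow> (g has_vector_derivative g' x) (at x within {0..b})"
    using assms(3) unfolding C_diff.simps by blast
  have "C_diff b k (\<lambda>x. integral {0..x} (\<lambda>s. q s * g s))"
    using C_diff_integral[OF C_diff_mult[OF assms(2) C_diff_Suc_D[OF assms(3)]]] by (rule C_diff_Suc_D)
  then have "C_diff b k (\<lambda>x. (- g' 0 / 2 + 1 / 2 * g' x) + (- 1 / 2) * integral {0..x} (\<lambda>s. q s * g s))"
    using g'(1) by (intro C_diff_lincomb C_diff_const)
  then show ?thesis
  proof (rule C_diff_cong)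
    fix x assume x: "x \<in> {0..b}"
    have "vector_derivative g (at y within {0..b}) = g' y" if "y \<in> {0..b}" for y
      using vector_derivative_within_closed_interval[OF assms(1) that g'(2)[OF that]] .
    then show "(- g' 0 / 2 + 1 / 2 * g' x) + (- 1 / 2) * integral {0..x} (\<lambda>s. q s * g s) = gamma21 q b g x"
      using x assms(1) by (simp add: gamma21_def field_simps)
  qed
qed

text \<open>
  The first application of \<open>\<gamma>\<^sub>2\<gamma>\<^sub>1\<close> turns \<open>1\<close> into \<open>-\<integral>q/2\<close>, which has one derivative more than
  \<open>q\<close>; each later application costs one derivative, because it differentiates its argument.
\<close>
lemma C_diff_gamma21_iterate_one:
  assumes "b > 0" "C_diff b k q" "i \<le> k"
  shows "C_diff b (Suc k - i) ((gamma21 q b ^^ Suc i) (\<lambda>x. 1))"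
  using assms(3)
proof (induction i)
  case 0
  have "C_diff b (Suc k) (\<lambda>x. 0 + (- 1 / 2) * integral {0..x} q)"
    by (intro C_diff_lincomb C_diff_const C_diff_integral assms)
  then have "C_diff b (Suc k) (gamma21 q b (\<lambda>x. 1))"
    by (rule C_diff_cong)
       (use assms(1) in \<open>simp add: gamma21_def vector_derivative_within_closed_interval[of 0 b, OF _ _ has_vector_derivative_const]\<close>)
  then show ?case by simp
next
  case (Suc i)
  then have "C_diff b (Suc (k - i)) ((gamma21 q b ^^ Suc i) (\<lambda>x. 1))" by (simp add: Suc_diff_le)
  then have "C_diff b (k - i) (gamma21 q b ((gamma21 q b ^^ Suc i) (\<lambda>x. 1)))"
    by (intro C_diff_gamma21 assms C_diff_mono[OF assms(2)]) auto
  then show ?case by simp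
qed

text \<open>
  For \<open>i = k + 1\<close>, the hypothesis gives \<open>q \<in> C\<^sup>k\<close> and the preceding count leaves \<open>D\<^sup>i[1] \<in> C\<^sup>1\<close>.
\<close>
lemma gamma21_iterate_one_differentiable:
  assumes "b > 0" "sobolev2 b i q" "x \<in> {0..b}"
  shows "(gamma21 q b ^^ i) (\<lambda>x. 1) differentiable (at x within {0..b})"
proof (cases i)
  case 0
  then show ?thesis by simp
next
  case (Suc k)
  then have "C_diff b 1 ((gamma21 q b ^^ i) (\<lambda>x. 1))"
    using C_diff_gamma21_iterate_one[OF assms(1) sobolev2_imp_C_diff, of k q k] assms by simp
  then show ?thesis using assms(3) by (auto intro: differentiableI_vector)
qed

section \<open>Diagonal traces of the wave polynomials\<close>

text \<open>
  The diagonal values of \<open>\<Sum> t\<^sup>k/k! A\<^sub>m\<^sub>-\<^sub>k(x)\<close> over the \<open>k\<close> of the same parity as \<open>p\<close>. For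
  \<open>A\<^sub>n = \<phi>\<^sub>n/n!\<close> this is \<open>c\<^sub>m/m!\<close> if \<open>p\<close> is even and \<open>s\<^sub>m/m!\<close> if \<open>p\<close> is odd. Letting \<open>p\<close> be any number
  makes both cases one statement and turns the exchange of the parities into \<open>p \<mapsto> p + 1\<close>.
\<close>
definition parity_sum :: "(nat \<Rightarrow> real \<Rightarrow> complex) \<Rightarrow> nat \<Rightarrow> nat \<Rightarrow> real \<Rightarrow> complex" where
  "parity_sum A p m x =
     (\<Sum>k\<le>m. if even (k + p) then of_real x ^ k / fact k * A (m - k) x else 0)"

lemma parity_sum_Suc_Suc [simp]: "parity_sum A (Suc (Suc p)) m = parity_sum A p m"
  by (simp add: parity_sum_def fun_eq_iff)

lemma parity_sum_at_0: "parity_sum A p m 0 = (if even p then A m 0 else 0)"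
proof -
  have "parity_sum A p m 0 = (\<Sum>k\<le>m. if k = 0 then (if even p then A m 0 else 0) else 0)"
    unfolding parity_sum_def by (intro sum.cong) (auto simp: power_0_left)
  then show ?thesis by simp
qed

lemma has_vector_derivative_power_over_fact:
  "((\<lambda>x. of_real x ^ k / fact k :: complex) has_vector_derivative
      (case k of 0 \<Rightarrow> 0 | Suc l \<Rightarrow> of_real x ^ l / fact l)) (at x within S)"
proof -
  have "((\<lambda>z. z ^ k / fact k :: complex) has_field_derivative
      (case k of 0 \<Rightarrow> 0 | Suc l \<Rightarrow> of_real x ^ l / fact l)) (at (of_real x))"
  proof (cases k)
    case (Suc l)
    then show ?thesis
      using DERIV_cdivide[OF DERIV_power[OF DERIV_ident, where x = "complex_of_real x" and s = UNIV and n = k], of "fact k"]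
      by (simp del: of_nat_Suc)
  qed simp
  then show ?thesis
    by (rule has_vector_derivative_real_field)
qed

text \<open>
  Differentiating the powers lowers \<open>k\<close>, hence flips the parity; differentiating \<open>A\<^sub>m\<^sub>-\<^sub>k\<close>
  reproduces the sum with the factor \<open>h\<close> and lowers the index in \<open>B\<close>. The factorials make
  all binomial coefficients disappear.
\<close>
lemma parity_sum_has_vector_derivative:
  assumes "\<And>n. (A n has_vector_derivative h * A n x + (case n of 0 \<Rightarrow> 0 | Suc l \<Rightarrow> B l x))
     (at x within S)"
  shows "(parity_sum A p m has_vector_derivative h * parity_sum A p m x +
      (case m of 0 \<Rightarrow> 0 | Suc l \<Rightarrow> parity_sum A (Suc p) l x + parity_sum B p l x)) (at x within S)"
proof -
  define T where "T k = (of_real x ^ k / fact k :: complex)" for k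
  define T' where "T' k = (case k of 0 \<Rightarrow> 0 | Suc l \<Rightarrow> T l)" for k
  have T'_0: "T' 0 = 0" by (simp add: T'_def)
  define B' where "B' n = (case n of 0 \<Rightarrow> 0 | Suc l \<Rightarrow> B l x)" for n
  have d: "(parity_sum A p m has_vector_derivative
      (\<Sum>k\<le>m. if even (k + p) then T k * (h * A (m - k) x + B' (m - k)) + T' k * A (m - k) x else 0))
      (at x within S)"
    unfolding parity_sum_def [abs_def]
  proof (rule has_vector_derivative_sum)
    fix k
    show "((\<lambda>x. if even (k + p) then of_real x ^ k / fact k * A (m - k) x else 0) has_vector_derivative
       (if even (k + p) then T k * (h * A (m - k) x + B' (m - k)) + T' k * A (m - k) x else 0))
       (at x within S)"
      using has_vector_derivative_mult[OF has_vector_derivative_power_over_fact[of k x S] assms[of "m - k"]]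
      by (cases k) (auto simp: T_def T'_def B'_def)
  qed
  have "(\<Sum>k\<le>m. if even (k + p) then T k * (h * A (m - k) x + B' (m - k)) + T' k * A (m - k) x else 0)
     = h * parity_sum A p m x + (\<Sum>k\<le>m. if even (k + p) then T' k * A (m - k) x else 0)
        + (\<Sum>k\<le>m. if even (k + p) then T k * B' (m - k) else 0)"
    unfolding parity_sum_def T_def[symmetric] sum_distrib_left sum.distrib[symmetric]
    by (intro sum.cong refl) (simp add: algebra_simps)
  also have "(\<Sum>k\<le>m. if even (k + p) then T' k * A (m - k) x else 0)
     = (case m of 0 \<Rightarrow> 0 | Suc l \<Rightarrow> parity_sum A (Suc p) l x)"
  proof (cases m)
    case (Suc l)
    then show ?thesis
      by (simp add: sum.atMost_Suc_shift T'_def parity_sum_def T_def del: sum.atMost_Suc)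
         (auto intro!: sum.cong simp: T'_def T_def)
  next
    case 0
    have "(\<Sum>k\<le>m. if even (k + p) then T' k * A (m - k) x else 0) = 0"
      by (rule sum.neutral) (use 0 T'_0 in auto)
    then show ?thesis using 0 by simp
  qed
  also have "(\<Sum>k\<le>m. if even (k + p) then T k * B' (m - k) else 0)
     = (case m of 0 \<Rightarrow> 0 | Suc l \<Rightarrow> parity_sum B p l x)"
  proof (cases m)
    case (Suc l)
    have "(\<Sum>k\<le>l. if even (k + p) then T k * B' (Suc l - k) else 0) = parity_sum B p l x"
      unfolding parity_sum_def
      by (intro sum.cong refl) (auto simp: Suc_diff_le B'_def T_def)
    then show ?thesis unfolding Suc by (simp add: B'_def)
  next
    case 0
    have "(\<Sum>k\<le>m. if even (k + p) then T k * B' (m - k) else 0) = 0"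
      by (rule sum.neutral) (use 0 in \<open>auto simp: B'_def\<close>)
    then show ?thesis using 0 by simp
  qed
  finally have eq: "(\<Sum>k\<le>m. if even (k + p) then T k * (h * A (m - k) x + B' (m - k)) + T' k * A (m - k) x else 0)
     = h * parity_sum A p m x +
      (case m of 0 \<Rightarrow> 0 | Suc l \<Rightarrow> parity_sum A (Suc p) l x + parity_sum B p l x)"
    by (cases m) simp_all
  show ?thesis using d unfolding eq .
qed

lemma iterated_integral_derivative:
  fixes u w :: "real \<Rightarrow> complex"
  assumes "continuous_on {0..d} u" "continuous_on {0..d} w" "x \<in> {0..d}"
  shows "((\<lambda>x. c * integral {0..x} (\<lambda>s. u s * w s)) has_vector_derivative c * (u x * w x)) (at x within {0..d})"
proof -
  have "continuous_on {0..d} (\<lambda>s. u s * w s)" using assms by (intro continuous_intros)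
  from integral_has_vector_derivative[OF this assms(3)]
  show ?thesis by (rule has_vector_derivative_mult_right)
qed

lemma continuous_on_powi_sign:
  assumes "continuous_on S f" "\<And>x. x \<in> S \<Longrightarrow> f x \<noteq> (0::complex)"
  shows "continuous_on S (\<lambda>x. (f x)\<^sup>2 powi ((- 1) ^ n))"
  using assms by (cases "even n") (auto simp: power_int_minus intro!: continuous_intros)

lemma X_fun_derivative:
  assumes "continuous_on {0..d} f" "\<And>x. x \<in> {0..d} \<Longrightarrow> f x \<noteq> 0"
  shows "x \<in> {0..d} \<Longrightarrow> (X_fun f (Suc n) has_vector_derivative
      of_nat (Suc n) * (X_fun f n x * (f x)\<^sup>2 powi ((- 1) ^ Suc n))) (at x within {0..d})"
    and "x \<in> {0..d} \<Longrightarrow> (Xt_fun f (Suc n) has_vector_derivative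
      of_nat (Suc n) * (Xt_fun f n x * (f x)\<^sup>2 powi ((- 1) ^ n))) (at x within {0..d})"
proof -
  have c: "continuous_on {0..d} (X_fun f n) \<and> continuous_on {0..d} (Xt_fun f n)" for n
  proof (induction n)
    case (Suc n)
    then show ?case
      using has_vector_derivative_continuous[OF iterated_integral_derivative]
        continuous_on_powi_sign[OF assms]
      unfolding X_fun.simps Xt_fun.simps continuous_on_eq_continuous_within by blast
  qed auto
  show "x \<in> {0..d} \<Longrightarrow> (X_fun f (Suc n) has_vector_derivative
      of_nat (Suc n) * (X_fun f n x * (f x)\<^sup>2 powi ((- 1) ^ Suc n))) (at x within {0..d})"
    unfolding X_fun.simps
    by (rule iterated_integral_derivative) (use c continuous_on_powi_sign[OF assms, of "Suc n"] in auto)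
  show "x \<in> {0..d} \<Longrightarrow> (Xt_fun f (Suc n) has_vector_derivative
      of_nat (Suc n) * (Xt_fun f n x * (f x)\<^sup>2 powi ((- 1) ^ n))) (at x within {0..d})"
    unfolding Xt_fun.simps
    by (rule iterated_integral_derivative) (use c continuous_on_powi_sign[OF assms] in auto)
qed

text \<open>
  These are the functions \<open>\<phi>\<^sub>k\<close> formed with \<open>1/f\<close> in place of \<open>f\<close>, which exchanges the two systems
  of recursive integrals. They belong to the equation solved by \<open>1/f\<close> (the Darboux transform),
  and together with the \<open>\<phi>\<^sub>k\<close> they satisfy a closed first-order system.
\<close>
definition psi_fun :: "(real \<Rightarrow> complex) \<Rightarrow> nat \<Rightarrow> real \<Rightarrow> complex" where
  "psi_fun f k x = (if odd k then Xt_fun f k x / f x else X_fun f k x / f x)"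

lemma has_vector_derivative_inverse:
  fixes f :: "real \<Rightarrow> complex"
  assumes "(f has_vector_derivative f') (at x within S)" "f x \<noteq> 0"
  shows "((\<lambda>x. inverse (f x)) has_vector_derivative - f' / (f x)\<^sup>2) (at x within S)"
  using field_vector_diff_chain_within[OF assms(1) DERIV_inverse[OF assms(2)]]
  by (simp add: o_def divide_inverse power2_eq_square)

text \<open>
  In the recursive integrals the weight is \<open>f\<^sup>-\<^sup>2\<close> when the integral belongs to some \<open>\<phi>\<^sub>n\<close> and
  \<open>f\<^sup>2\<close> when it belongs to some \<open>\<psi>\<^sub>n\<close>, whatever the parity of \<open>n\<close>. So differentiating the integral
  leads to the function of the other kind, while the outer factor \<open>f\<close> or \<open>1/f\<close> contributes
  its logarithmic derivative \<open>f'/f\<close> or \<open>-f'/f\<close>.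
\<close>
lemma phi_psi_derivative:
  assumes f: "\<And>x. x \<in> {0..d} \<Longrightarrow> (f has_vector_derivative f' x) (at x within {0..d})"
    and nz: "\<And>x. x \<in> {0..d} \<Longrightarrow> f x \<noteq> 0" and x: "x \<in> {0..d}"
  shows "((\<lambda>x. phi_fun f n x / fact n) has_vector_derivative
       f' x / f x * (phi_fun f n x / fact n) + (case n of 0 \<Rightarrow> 0 | Suc l \<Rightarrow> psi_fun f l x / fact l))
       (at x within {0..d})" (is ?phi)
    and "((\<lambda>x. psi_fun f n x / fact n) has_vector_derivative
       - (f' x / f x) * (psi_fun f n x / fact n) + (case n of 0 \<Rightarrow> 0 | Suc l \<Rightarrow> phi_fun f l x / fact l))
       (at x within {0..d})" (is ?psi)
proof -
  have c: "continuous_on {0..d} f"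
    using f has_vector_derivative_continuous unfolding continuous_on_eq_continuous_within by blast
  have [simp]: "f x \<noteq> 0" using nz x by simp
  have inv: "((\<lambda>x. inverse (f x)) has_vector_derivative - f' x / (f x)\<^sup>2) (at x within {0..d})"
    by (rule has_vector_derivative_inverse[OF f[OF x]]) simp
  note X = X_fun_derivative(1)[OF c nz x] and Xt = X_fun_derivative(2)[OF c nz x]
  have fact: "fact (Suc l) = of_nat (Suc l) * (fact l :: complex)" for l
    by (rule fact_Suc)
  have phi_alg: "(F * (c * (y * inverse (F\<^sup>2))) + F' * Y) / (c * K) = F' / F * (F * Y / (c * K)) + y / F / K"
    if "c \<noteq> 0" "K \<noteq> 0" "F \<noteq> 0" for F F' Y y c K :: complex
    using that by (simp add: field_simps power2_eq_square)
  have psi_alg: "(Y * (- F' / F\<^sup>2) + c * (y * F\<^sup>2) * inverse F) / (c * K)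
      = - (F' / F) * (Y * inverse F / (c * K)) + F * y / K"
    if "c \<noteq> 0" "K \<noteq> 0" "F \<noteq> 0" for F F' Y y c K :: complex
    using that by (simp add: field_simps power2_eq_square)
  have phi_prod: "((\<lambda>x. f x * Y x / fact (Suc l)) has_vector_derivative
        f' x / f x * (f x * Y x / fact (Suc l)) + y / f x / fact l) (at x within {0..d})"
    if "(Y has_vector_derivative of_nat (Suc l) * (y * inverse ((f x)\<^sup>2))) (at x within {0..d})"
    for Y y l
    using has_vector_derivative_divide[OF has_vector_derivative_mult[OF f[OF x] that], of "fact (Suc l)"]
    by (rule has_vector_derivative_eq_rhs)
       (unfold fact, rule phi_alg, simp_all del: of_nat_Suc)
  have psi_prod: "((\<lambda>x. Y x / f x / fact (Suc l)) has_vector_derivative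
        - (f' x / f x) * (Y x / f x / fact (Suc l)) + f x * y / fact l) (at x within {0..d})"
    if "(Y has_vector_derivative of_nat (Suc l) * (y * (f x)\<^sup>2)) (at x within {0..d})" for Y y l
    unfolding divide_inverse[of "Y _" "f _"] fact
    using has_vector_derivative_divide[OF has_vector_derivative_mult[OF that inv], of "of_nat (Suc l) * fact l"]
    by (rule has_vector_derivative_eq_rhs) (rule psi_alg, simp_all del: of_nat_Suc)
  show ?phi
  proof (cases n)
    case 0
    then show ?thesis using f[OF x] by (simp add: phi_fun_def)
  next
    case (Suc l)
    then show ?thesis
      using phi_prod[of "X_fun f n" l "X_fun f l x"] X[of l]
        phi_prod[of "Xt_fun f n" l "Xt_fun f l x"] Xt[of l]
      by (cases "even l")
         (simp_all add: phi_fun_def psi_fun_def power_int_minus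
           del: X_fun.simps Xt_fun.simps fact_Suc of_nat_Suc)
  qed
  show ?psi
  proof (cases n)
    case 0
    then show ?thesis using inv by (simp add: psi_fun_def inverse_eq_divide power2_eq_square)
  next
    case (Suc l)
    then show ?thesis
      using psi_prod[of "X_fun f n" l "X_fun f l x"] X[of l]
        psi_prod[of "Xt_fun f n" l "Xt_fun f l x"] Xt[of l]
      by (cases "even l")
         (simp_all add: phi_fun_def psi_fun_def power_int_minus
           del: X_fun.simps Xt_fun.simps fact_Suc of_nat_Suc)
  qed
qed

definition wave_trace :: "(real \<Rightarrow> complex) \<Rightarrow> nat \<Rightarrow> nat \<Rightarrow> real \<Rightarrow> complex" where
  "wave_trace f = parity_sum (\<lambda>n x. phi_fun f n x / fact n)"

lemma phi_psi_at_0: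
  assumes "f 0 = 1"
  shows "phi_fun f n 0 = (if n = 0 then 1 else 0)" "psi_fun f n 0 = (if n = 0 then 1 else 0)"
  using assms by (cases n; simp add: phi_fun_def psi_fun_def)+

lemma wave_trace_at_0:
  assumes "f 0 = 1"
  shows "wave_trace f p m 0 = (if even p \<and> m = 0 then 1 else 0)"
  using phi_psi_at_0[of f, OF assms] by (simp add: wave_trace_def parity_sum_at_0)

lemma wave_trace_eq:
  "wave_trace f 0 m x = c_fun f m x / fact m" "wave_trace f 1 m x = s_fun f m x / fact m"
proof -
  have *: "of_real x ^ k * phi_fun f (m - k) x / (fact k * fact (m - k))
     = of_nat (m choose k) * of_real x ^ k * phi_fun f (m - k) x / fact m" if "k \<le> m" for k
    using that by (simp add: binomial_fact)
  have c: "{k \<in> {0..m}. even k} = {..m} \<inter> {k. even k}"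
    and s: "{k \<in> {1..m}. odd k} = {..m} \<inter> {k. odd k}" by (auto elim: oddE)
  show "wave_trace f 0 m x = c_fun f m x / fact m"
    unfolding wave_trace_def parity_sum_def c_fun_def c sum_divide_distrib
    by (subst sum.inter_restrict) (auto intro!: sum.cong simp: *)
  show "wave_trace f 1 m x = s_fun f m x / fact m"
    unfolding wave_trace_def parity_sum_def s_fun_def s sum_divide_distrib
    by (subst sum.inter_restrict) (auto intro!: sum.cong simp: *)
qed

text \<open>
  As \<open>f(0) = 1\<close>, the number \<open>g'(0) - f'(0) g(0)\<close> is \<open>\<gamma>\<^sub>1 g(0)\<close>, and the derivative is written so that
  this number can be read off. For \<open>m = 1\<close> its value \<open>1\<close> is contributed by \<open>\<psi>\<^sub>0(0)\<close> when \<open>p\<close> is even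
  and by \<open>\<phi>\<^sub>0(0)\<close> when \<open>p\<close> is odd.
\<close>
lemma wave_trace_derivative_0:
  assumes f: "\<And>x. x \<in> {0..d} \<Longrightarrow> (f has_vector_derivative f' x) (at x within {0..d})"
    and nz: "\<And>x. x \<in> {0..d} \<Longrightarrow> f x \<noteq> 0" and "0 \<le> d" "f 0 = 1"
  shows "(wave_trace f p m has_vector_derivative
      (if m = 1 then 1 else 0) + f' 0 * wave_trace f p m 0) (at 0 within {0..d})"
proof -
  have "(wave_trace f p m has_vector_derivative f' 0 / f 0 * wave_trace f p m 0 +
      (case m of 0 \<Rightarrow> 0 | Suc l \<Rightarrow> wave_trace f (Suc p) l 0 +
        parity_sum (\<lambda>n x. psi_fun f n x / fact n) p l 0)) (at 0 within {0..d})"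
    unfolding wave_trace_def
    by (intro parity_sum_has_vector_derivative phi_psi_derivative) (use f nz assms in auto)
  moreover have "f' 0 / f 0 * wave_trace f p m 0 +
      (case m of 0 \<Rightarrow> 0 | Suc l \<Rightarrow> wave_trace f (Suc p) l 0 +
        parity_sum (\<lambda>n x. psi_fun f n x / fact n) p l 0)
     = (if m = 1 then 1 else 0) + f' 0 * wave_trace f p m 0"
    by (auto simp: assms(4) wave_trace_at_0 parity_sum_at_0 phi_psi_at_0 split: nat.split)
  ultimately show ?thesis by metis
qed

text \<open>
  With \<open>W = wave_trace f p m\<close>, \<open>h = f'/f\<close> and \<open>V\<close>, \<open>W\<^sup>-\<close> the sums of index \<open>m - 1\<close> formed from the \<open>\<psi>\<^sub>n\<close>
  with parity \<open>p\<close> and from the \<open>\<phi>\<^sub>n\<close> with parity \<open>p + 1\<close>, one has \<open>W' = h W + V + W\<^sup>-\<close>. The combination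
  \<open>H = h W + V - W\<^sup>-\<close> has derivative \<open>q W\<close>, by \<open>h' = q - h\<^sup>2\<close>. So \<open>W' = 2 W\<^sup>- + H\<close> is
  \<open>2 W\<^sup>-\<close> plus an antiderivative of \<open>q W\<close>.
\<close>
lemma gamma21_rel_wave_trace:
  assumes f: "\<And>x. x \<in> {0..d} \<Longrightarrow> (f has_vector_derivative f' x) (at x within {0..d})"
    and f': "\<And>x. x \<in> {0..d} \<Longrightarrow> (f' has_vector_derivative q x * f x) (at x within {0..d})"
    and nz: "\<And>x. x \<in> {0..d} \<Longrightarrow> f x \<noteq> 0"
  shows "gamma21_rel q d (wave_trace f p m)
     (\<lambda>x. case m of 0 \<Rightarrow> 0 | Suc l \<Rightarrow> wave_trace f (Suc p) l x - wave_trace f (Suc p) l 0)"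
proof -
  define W where "W = wave_trace f"
  define V where "V = parity_sum (\<lambda>n x. psi_fun f n x / fact n)"
  define h where "h x = f' x / f x" for x
  have W: "(W p m has_vector_derivative h x * W p m x +
      (case m of 0 \<Rightarrow> 0 | Suc l \<Rightarrow> W (Suc p) l x + V p l x)) (at x within {0..d})"
    if "x \<in> {0..d}" for p m x
    unfolding W_def wave_trace_def V_def h_def
    by (intro parity_sum_has_vector_derivative phi_psi_derivative) (use f nz that in auto)
  have V: "(V p m has_vector_derivative - h x * V p m x +
      (case m of 0 \<Rightarrow> 0 | Suc l \<Rightarrow> V (Suc p) l x + W p l x)) (at x within {0..d})"
    if "x \<in> {0..d}" for p m x
    unfolding W_def wave_trace_def V_def h_def
    by (intro parity_sum_has_vector_derivative phi_psi_derivative) (use f nz that in auto)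
  have h: "(h has_vector_derivative q x - (h x)\<^sup>2) (at x within {0..d})" if x: "x \<in> {0..d}" for x
  proof -
    have "((\<lambda>x. inverse (f x)) has_vector_derivative - f' x / (f x)\<^sup>2) (at x within {0..d})"
      by (rule has_vector_derivative_inverse[OF f[OF x] nz[OF x]])
    from has_vector_derivative_mult[OF f'[OF x] this]
    have "((\<lambda>x. f' x * inverse (f x)) has_vector_derivative q x - (h x)\<^sup>2) (at x within {0..d})"
      by (rule has_vector_derivative_eq_rhs)
         (use nz[OF x] in \<open>simp add: h_def field_simps power2_eq_square\<close>)
    then show ?thesis by (simp add: h_def[abs_def] divide_inverse)
  qed
  define H where "H x = h x * W p m x + (case m of 0 \<Rightarrow> 0 | Suc l \<Rightarrow> V p l x - W (Suc p) l x)" for x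
  have H: "(H has_vector_derivative q x * W p m x) (at x within {0..d})" if x: "x \<in> {0..d}" for x
  proof (cases m)
    case 0
    show ?thesis using has_vector_derivative_mult[OF h[OF x] W[OF x, of p 0]] 0
      by (simp add: H_def[abs_def] power2_eq_square algebra_simps)
  next
    case (Suc l)
    have WSS: "W (Suc (Suc p)) = W p" by (simp add: W_def wave_trace_def fun_eq_iff)
    show ?thesis
      using has_vector_derivative_add[OF has_vector_derivative_mult[OF h[OF x] W[OF x, of p m]]
          has_vector_derivative_diff[OF V[OF x, of p l] W[OF x, of "Suc p" l]]] Suc
      by (simp add: H_def[abs_def] WSS power2_eq_square algebra_simps split: nat.splits)
  qed
  have int: "integral {0..x} (\<lambda>s. q s * W p m s) = H x - H 0" if "x \<in> {0..d}" for x
    by (intro integral_unique fundamental_theorem_of_calculus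
         has_vector_derivative_within_subset[OF H]) (use that in auto)
  show ?thesis
    unfolding gamma21_rel_def W_def[symmetric]
  proof (intro exI ballI conjI)
    fix x assume x: "x \<in> {0..d}"
    show "(W p m has_vector_derivative h x * W p m x +
      (case m of 0 \<Rightarrow> 0 | Suc l \<Rightarrow> W (Suc p) l x + V p l x)) (at x within {0..d})" by (rule W[OF x])
    show "(case m of 0 \<Rightarrow> 0 | Suc l \<Rightarrow> W (Suc p) l x - W (Suc p) l 0) =
       (h x * W p m x + (case m of 0 \<Rightarrow> 0 | Suc l \<Rightarrow> W (Suc p) l x + V p l x) -
        (h 0 * W p m 0 + (case m of 0 \<Rightarrow> 0 | Suc l \<Rightarrow> W (Suc p) l 0 + V p l 0)) -
        integral {0..x} (\<lambda>s. q s * W p m s)) / 2"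
      unfolding int[OF x] by (cases m) (simp_all add: H_def)
  qed
qed

section \<open>The expansion at 0\<close>

lemma gamma1_exists_imp_differentiable:
  assumes "gamma1_exists f b g x" "f differentiable (at x within {0..b})"
    and "\<forall>x\<in>{0..b}. f x \<noteq> 0" "x \<in> {0..b}"
  shows "g differentiable (at x within {0..b})"
proof -
  have "(\<lambda>t. g t / f t * f t) differentiable (at x within {0..b})"
    using assms(1,2) unfolding gamma1_exists_def by (rule differentiable_mult)
  then show ?thesis
    by (rule differentiable_transform_within[of _ _ _ 1]) (use assms in auto)
qed

text \<open>
  The product rule for \<open>g = (g/f) f\<close> at \<open>0\<close>, where \<open>f = 1\<close>.
\<close>
lemma gamma1_derivative_at_0:
  assumes "0 < b" "gamma1_exists f b g 0" "f 0 = 1"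
    and "(f has_vector_derivative f') (at 0 within {0..b})" "\<forall>x\<in>{0..b}. f x \<noteq> 0"
  shows "(g has_vector_derivative gamma1 f b g 0 + f' * g 0) (at 0 within {0..b})"
proof -
  have "((\<lambda>t. g t / f t) has_vector_derivative gamma1 f b g 0) (at 0 within {0..b})"
    using assms(2,3) unfolding gamma1_exists_def gamma1_def by (simp add: vector_derivative_works)
  from has_vector_derivative_mult[OF this assms(4)]
  have "((\<lambda>t. g t / f t * f t) has_vector_derivative gamma1 f b g 0 + f' * g 0) (at 0 within {0..b})"
    using assms(3) by (simp add: ac_simps)
  then show ?thesis
    by (rule has_vector_derivative_transform[rotated 2]) (use assms(1,5) in auto)
qed

text \<open>
  The iterate \<open>(\<gamma>\<^sub>2\<gamma>\<^sub>1)\<^sup>j\<close> on the trace of index \<open>n\<close> and parity \<open>p\<close>. The constant \<open>1\<close> is split off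
  at the step from \<open>j = n - 1\<close> to \<open>j = n\<close>, where \<open>s\<^sub>1\<close> is mapped to \<open>c\<^sub>0 - 1\<close>, provided that the
  trace of index \<open>1\<close> reached there is \<open>s\<^sub>1\<close> and not \<open>c\<^sub>1\<close>, that is, if \<open>n + p\<close> is even.
\<close>
definition trace_chain :: "(real \<Rightarrow> complex) \<Rightarrow> (real \<Rightarrow> complex) \<Rightarrow> real \<Rightarrow> nat \<Rightarrow> nat \<Rightarrow> nat \<Rightarrow> real \<Rightarrow> complex"
  where "trace_chain q f b p n j x =
     (if j \<le> n then wave_trace f (p + j) (n - j) x else 0) -
     (if 1 \<le> n \<and> n \<le> j \<and> even (n + p) then (gamma21 q b ^^ (j - n)) (\<lambda>_. 1) x else 0)"

lemma gamma21_rel_trace_chain: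
  assumes "0 < d" "d \<le> b" "continuous_on {0..b} q" "f 0 = 1"
    and f: "\<And>x. x \<in> {0..d} \<Longrightarrow> (f has_vector_derivative f' x) (at x within {0..d})"
    and f': "\<And>x. x \<in> {0..d} \<Longrightarrow> (f' has_vector_derivative q x * f x) (at x within {0..d})"
    and nz: "\<And>x. x \<in> {0..d} \<Longrightarrow> f x \<noteq> 0"
    and reg: "1 \<le> n \<Longrightarrow> n \<le> j \<Longrightarrow> even (n + p) \<Longrightarrow> sobolev2 b (j - n) q"
  shows "gamma21_rel q d (trace_chain q f b p n j) (trace_chain q f b p n (Suc j))"
proof -
  have q: "continuous_on {0..d} q" using assms(2,3) by (auto intro: continuous_on_subset)
  note W = gamma21_rel_wave_trace[of d f f' q, OF f f' nz]
  show ?thesis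
  proof (cases "j < n")
    case True
    define l where "l = n - Suc j"
    with True have l: "n - j = Suc l" "n - Suc j = l" by simp_all
    have "trace_chain q f b p n j = wave_trace f (p + j) (n - j)"
      using True by (auto simp: trace_chain_def fun_eq_iff)
    moreover have "trace_chain q f b p n (Suc j) =
      (\<lambda>x. wave_trace f (Suc (p + j)) l x - wave_trace f (Suc (p + j)) l 0)"
    proof
      fix x
      have "n = Suc (j + l)" using True l by simp
      then have "(1 \<le> n \<and> n \<le> Suc j \<and> even (n + p)) = (even (Suc (p + j)) \<and> l = 0)"
        by (cases l) auto
      then show "trace_chain q f b p n (Suc j) x =
        wave_trace f (Suc (p + j)) l x - wave_trace f (Suc (p + j)) l 0"
        using True l(2) wave_trace_at_0[of f "Suc (p + j)" l, OF assms(4)]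
        by (auto simp: trace_chain_def)
    qed
    ultimately show ?thesis using W[of "p + j" "Suc l"] l by simp
  next
    case False
    define e where "e = (if 1 \<le> n \<and> even (n + p) then 1 else 0 :: complex)"
    have 1: "trace_chain q f b p n j = (\<lambda>x. (if j = n then wave_trace f (p + n) 0 x else 0)
        + (- e) * (gamma21 q b ^^ (j - n)) (\<lambda>_. 1) x)"
      using False by (auto simp: trace_chain_def fun_eq_iff e_def)
    have 2: "trace_chain q f b p n (Suc j) = (\<lambda>x. 0 + (- e) * (gamma21 q b ^^ Suc (j - n)) (\<lambda>_. 1) x)"
      using False by (auto simp: trace_chain_def fun_eq_iff e_def Suc_diff_le)
    have a: "gamma21_rel q d (\<lambda>x. if j = n then wave_trace f (p + n) 0 x else 0) (\<lambda>x. 0)"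
      using W[of "p + n" 0] gamma21_rel_zero by (cases "j = n") simp_all
    show ?thesis
    proof (cases "e = 0")
      case True
      then show ?thesis unfolding 1 2 using a by simp
    next
      case False
      then have "sobolev2 b (j - n) q" using reg \<open>\<not> j < n\<close> by (auto simp: e_def split: if_splits)
      then have "gamma21_rel q d ((gamma21 q b ^^ (j - n)) (\<lambda>_. 1)) ((gamma21 q b ^^ Suc (j - n)) (\<lambda>_. 1))"
        unfolding funpow.simps o_def
        by (intro gamma21_rel_gamma21 gamma21_iterate_one_differentiable) (use assms(1,2) in auto)
      then show ?thesis unfolding 1 2 by (intro gamma21_rel_lincomb q a)
    qed
  qed
qed

lemma trace_chain_derivative_0:
  assumes "0 < d" "d \<le> b" "f 0 = 1"
    and f: "\<And>x. x \<in> {0..b} \<Longrightarrow> (f has_vector_derivative f' x) (at x within {0..b})"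
    and nz: "\<forall>x\<in>{0..b}. f x \<noteq> 0"
    and reg: "1 \<le> n \<Longrightarrow> n \<le> j \<Longrightarrow> even (n + p) \<Longrightarrow> gamma1_exists f b ((gamma21 q b ^^ (j - n)) (\<lambda>_. 1)) 0"
  shows "(trace_chain q f b p n j has_vector_derivative
     (if n = Suc j then 1 else 0) -
     (if 1 \<le> n \<and> n \<le> j \<and> even (n + p) then gamma1 f b ((gamma21 q b ^^ (j - n)) (\<lambda>_. 1)) 0 else 0)
     + f' 0 * trace_chain q f b p n j 0) (at 0 within {0..b})"
proof -
  have a: "((\<lambda>x. if j \<le> n then wave_trace f (p + j) (n - j) x else 0) has_vector_derivative
     (if n = Suc j then 1 else 0) + f' 0 * (if j \<le> n then wave_trace f (p + j) (n - j) 0 else 0))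
     (at 0 within {0..b})"
  proof -
    have "(n - j = 1) = (n = Suc j)" by auto
    then show ?thesis
      using wave_trace_derivative_0[of b f f', OF f, of "p + j" "n - j"] nz assms(1-3)
      by (cases "j \<le> n") (simp_all del: One_nat_def)
  qed
  have b: "((\<lambda>x. if 1 \<le> n \<and> n \<le> j \<and> even (n + p) then (gamma21 q b ^^ (j - n)) (\<lambda>_. 1) x else 0)
     has_vector_derivative
     (if 1 \<le> n \<and> n \<le> j \<and> even (n + p) then gamma1 f b ((gamma21 q b ^^ (j - n)) (\<lambda>_. 1)) 0 else 0)
     + f' 0 * (if 1 \<le> n \<and> n \<le> j \<and> even (n + p) then (gamma21 q b ^^ (j - n)) (\<lambda>_. 1) 0 else 0))
     (at 0 within {0..b})"
    using gamma1_derivative_at_0[OF _ reg assms(3) f[of 0] nz] assms(1,2) by auto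
  show ?thesis
    unfolding trace_chain_def [abs_def]
    using has_vector_derivative_diff[OF a b] by (rule has_vector_derivative_eq_rhs) (simp add: algebra_simps)
qed

text \<open>
  Both expansions at once, \<open>p = 0\<close> giving the \<open>c\<^sub>n\<close> and \<open>p = 1\<close> the \<open>s\<^sub>n\<close>. The condition on \<open>F 0\<close>
  expresses \<open>R(0) = 0\<close>: the only trace that does not vanish at \<open>0\<close> is \<open>c\<^sub>0\<close>. The chain
  \<open>R, D R, \<dots>, D\<^sup>N\<^sup>-\<^sup>1 R\<close> is built termwise from those of \<open>F\<close> and of the traces on an interval \<open>[0,d]\<close>
  inside the neighbourhood on which \<open>F\<close> is regular.
\<close>
lemma wave_trace_expansion:
  assumes "b > 0"
    and q: "continuous_on {0..b} q"
    and sol: "schroedinger_solution q b f"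
    and f0: "f 0 = 1"
    and nz: "\<forall>x\<in>{0..b}. f x \<noteq> 0"
    and N: "N \<ge> 1"
    and F: "\<exists>\<delta>>0. \<forall>j<N. \<forall>x\<in>{0..b}. x < \<delta> \<longrightarrow> gamma1_exists f b ((gamma21 q b ^^ j) F) x"
    and reg: "\<And>j n. j < N \<Longrightarrow> 1 \<le> n \<Longrightarrow> n \<le> j \<Longrightarrow> even (n + p) \<Longrightarrow> regular_for q f b (j - n)"
    and F0: "F 0 = (if even p then a 0 else 0)"
    and a: "\<And>j. j < N \<Longrightarrow> a (Suc j) = gamma1 f b ((gamma21 q b ^^ j) F) 0 +
         (\<Sum>n\<in>{n\<in>{1..j}. even (n + p)}. a n * gamma1 f b ((gamma21 q b ^^ (j - n)) (\<lambda>_. 1)) 0)"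
  shows "(\<lambda>x. F x - (\<Sum>n=0..N. a n * wave_trace f p n x)) \<in> o[at 0 within {0..b}](\<lambda>x. of_real x ^ N)"
proof -
  obtain f' where f: "\<And>x. x \<in> {0..b} \<Longrightarrow> (f has_vector_derivative f' x) (at x within {0..b})"
    and f': "\<And>x. x \<in> {0..b} \<Longrightarrow> (f' has_vector_derivative q x * f x) (at x within {0..b})"
    using sol unfolding schroedinger_solution_def by blast
  obtain \<delta> where \<delta>: "\<delta> > 0"
    "\<And>j x. j < N \<Longrightarrow> x \<in> {0..b} \<Longrightarrow> x < \<delta> \<Longrightarrow> gamma1_exists f b ((gamma21 q b ^^ j) F) x"
    using F by blast
  define d where "d = min (\<delta> / 2) b"
  have d: "0 < d" "d \<le> b" "d < \<delta>" using \<delta>(1) assms(1) by (auto simp: d_def)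
  have sub: "{0..d} \<subseteq> {0..b}" using d by auto
  have qd: "continuous_on {0..d} q" using q sub by (rule continuous_on_subset)
  obtain M where M: "N = Suc M" using N by (cases N) auto
  define E where "E = trace_chain q f b p"
  define D where "D j = (gamma21 q b ^^ j) F" for j
  define G where "G j x = D j x - (\<Sum>n\<in>{0..N}. a n * E n j x)" for j x
  have D_diff: "D j differentiable (at x within {0..b})" if "j < N" "x \<in> {0..d}" for j x
    unfolding D_def
    by (rule gamma1_exists_imp_differentiable[OF \<delta>(2) differentiableI_vector[OF f] nz])
       (use that d in auto)
  have step: "gamma21_rel q d (G j) (G (Suc j))" if j: "j < M" for j
    unfolding G_def [abs_def]
  proof (rule gamma21_rel_sum[OF qd])
    show "gamma21_rel q d (D j) (D (Suc j))"
      using gamma21_rel_gamma21[OF d(1,2) D_diff, of j] j M by (simp add: D_def)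
    fix n
    \<comment> \<open>the convention for \<open>j + 1\<close>, a legitimate index as \<open>j < N - 1\<close>, controls \<open>D\<^sup>j\<^sup>-\<^sup>n[1]\<close> on all of \<open>[0,b]\<close>\<close>
    have "sobolev2 b (j - n) q" if "1 \<le> n" "n \<le> j" "even (n + p)"
      using reg[of "Suc j" n] that j M by (simp add: regular_for_def Suc_diff_le)
    then show "gamma21_rel q d (E n j) (E n (Suc j))"
      unfolding E_def using sub nz d q f0
      by (intro gamma21_rel_trace_chain[of d b q f f'])
         (auto intro: has_vector_derivative_within_subset[OF f sub] has_vector_derivative_within_subset[OF f' sub])
  qed simp
  have G0: "G 0 0 = 0"
  proof -
    have "(\<Sum>n\<in>{0..N}. a n * E n 0 0) = (\<Sum>n\<in>{0..N}. if n = 0 then (if even p then a 0 else 0) else 0)"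
      by (intro sum.cong refl) (auto simp: E_def trace_chain_def wave_trace_at_0[of f, OF f0])
    then show ?thesis by (simp add: G_def D_def F0)
  qed
  have G_at_0: "G j 0 = 0" if "j \<le> M" for j
    using that G0 gamma21_rel_at_0[OF step] d by (cases j) auto
  have deriv: "(G j has_vector_derivative 0) (at 0 within {0..d})" if j: "j \<le> M" for j
  proof -
    define w where "w n = (if n = Suc j then 1 else 0) -
     (if 1 \<le> n \<and> n \<le> j \<and> even (n + p) then gamma1 f b ((gamma21 q b ^^ (j - n)) (\<lambda>_. 1)) 0 else 0)" for n
    have "(G j has_vector_derivative (gamma1 f b (D j) 0 + f' 0 * D j 0)
        - (\<Sum>n\<in>{0..N}. a n * (w n + f' 0 * E n j 0))) (at 0 within {0..b})"
      unfolding G_def [abs_def]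
    proof (intro has_vector_derivative_diff has_vector_derivative_sum has_vector_derivative_mult_right)
      show "(D j has_vector_derivative gamma1 f b (D j) 0 + f' 0 * D j 0) (at 0 within {0..b})"
        unfolding D_def
        by (rule gamma1_derivative_at_0[OF assms(1) \<delta>(2) f0 f nz]) (use j M \<delta>(1) assms(1) in auto)
      fix n
      have "gamma1_exists f b ((gamma21 q b ^^ (j - n)) (\<lambda>_. 1)) 0" if "1 \<le> n" "n \<le> j" "even (n + p)"
        using reg[of j n] that j M by (simp add: regular_for_def)
      then show "(E n j has_vector_derivative w n + f' 0 * E n j 0) (at 0 within {0..b})"
        unfolding E_def w_def by (intro trace_chain_derivative_0[OF d(1,2) f0 f nz])
    qed
    also have "(gamma1 f b (D j) 0 + f' 0 * D j 0) - (\<Sum>n\<in>{0..N}. a n * (w n + f' 0 * E n j 0))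
       = gamma1 f b (D j) 0 - (\<Sum>n\<in>{0..N}. a n * w n) + f' 0 * G j 0"
      by (simp add: G_def algebra_simps sum.distrib sum_distrib_left)
    also have "(\<Sum>n\<in>{0..N}. a n * w n) = (\<Sum>n\<in>{0..N}. if n = Suc j then a n else 0) -
        (\<Sum>n\<in>{0..N}. if n \<in> {n\<in>{1..j}. even (n + p)} then
            a n * gamma1 f b ((gamma21 q b ^^ (j - n)) (\<lambda>_. 1)) 0 else 0)"
      unfolding sum_subtractf[symmetric] by (intro sum.cong refl) (auto simp: w_def)
    also have "(\<Sum>n\<in>{0..N}. if n = Suc j then a n else 0) = a (Suc j)"
      using j M by simp
    also have "(\<Sum>n\<in>{0..N}. if n \<in> {n\<in>{1..j}. even (n + p)} then
            a n * gamma1 f b ((gamma21 q b ^^ (j - n)) (\<lambda>_. 1)) 0 else 0)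
        = (\<Sum>n\<in>{n\<in>{1..j}. even (n + p)}. a n * gamma1 f b ((gamma21 q b ^^ (j - n)) (\<lambda>_. 1)) 0)"
    proof -
      have "{0..N} \<inter> {n\<in>{1..j}. even (n + p)} = {n\<in>{1..j}. even (n + p)}" using j M by auto
      then show ?thesis by (subst sum.inter_restrict[symmetric]) simp_all
    qed
    finally have "(G j has_vector_derivative 0) (at 0 within {0..b})"
      using a[of j] j M G_at_0[OF j] by (simp add: D_def)
    then show ?thesis using sub by (rule has_vector_derivative_within_subset)
  qed
  have "G 0 \<in> o[at_right 0](\<lambda>x. of_real x ^ Suc M)"
    by (rule smallo_gamma21_chain[OF d(1) qd step deriv G0])
  moreover have "G 0 = (\<lambda>x. F x - (\<Sum>n=0..N. a n * wave_trace f p n x))"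
  proof -
    have "E n 0 = wave_trace f p n" for n by (auto simp: E_def trace_chain_def fun_eq_iff)
    then show ?thesis by (simp add: G_def [abs_def] D_def)
  qed
  ultimately show ?thesis using M assms(1) by (simp add: at_within_Icc_at_right)
qed

theorem theorem4p10:
  fixes b :: real and q f F :: "real \<Rightarrow> complex" and N :: nat
    and \<alpha> \<beta> :: "nat \<Rightarrow> complex"
  assumes "b > 0"
    and "continuous_on {0..b} q"
    and "schroedinger_solution q b f"
    and "f 0 = 1"
    and "\<forall>x\<in>{0..b}. f x \<noteq> 0"
    and "N \<ge> 1"
    and "\<exists>\<delta>>0. \<forall>j<N. \<forall>x\<in>{0..b}. x < \<delta> \<longrightarrow> gamma1_exists f b ((gamma21 q b ^^ j) F) x"
    and "\<forall>j<N. continuous (at 0 within {0..b}) (gamma1 f b ((gamma21 q b ^^ j) F))"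
  shows
    "((\<forall>j<N. \<forall>n\<in>{2..j}. even n \<longrightarrow> regular_for q f b (j - n)) \<and>
      \<alpha> 0 = F 0 \<and>
      (\<forall>j<N. \<alpha> (j + 1) =
         gamma1 f b ((gamma21 q b ^^ j) F) 0 +
         (\<Sum>n\<in>{n\<in>{2..j}. even n}.
            \<alpha> n * gamma1 f b ((gamma21 q b ^^ (j - n)) (\<lambda>_. 1)) 0))
      \<longrightarrow>
      (\<lambda>x. F x - (\<Sum>n=0..N. \<alpha> n * (c_fun f n x / fact n)))
        \<in> o[at 0 within {0..b}](\<lambda>x. of_real x ^ N))
     \<and>
     (F 0 = 0 \<and>
      (\<forall>j<N. \<forall>n\<in>{1..j}. odd n \<longrightarrow> regular_for q f b (j - n)) \<and>
      (\<forall>j<N. \<beta> (j + 1) =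
         gamma1 f b ((gamma21 q b ^^ j) F) 0 +
         (\<Sum>n\<in>{n\<in>{1..j}. odd n}.
            \<beta> n * gamma1 f b ((gamma21 q b ^^ (j - n)) (\<lambda>_. 1)) 0))
      \<longrightarrow>
      (\<lambda>x. F x - (\<Sum>n=1..N. \<beta> n * (s_fun f n x / fact n)))
        \<in> o[at 0 within {0..b}](\<lambda>x. of_real x ^ N))"
proof (intro conjI impI; elim conjE)
  assume reg: "\<forall>j<N. \<forall>n\<in>{2..j}. even n \<longrightarrow> regular_for q f b (j - n)"
    and \<alpha>: "\<alpha> 0 = F 0" "\<forall>j<N. \<alpha> (j + 1) =
         gamma1 f b ((gamma21 q b ^^ j) F) 0 +
         (\<Sum>n\<in>{n\<in>{2..j}. even n}.
            \<alpha> n * gamma1 f b ((gamma21 q b ^^ (j - n)) (\<lambda>_. 1)) 0)"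
  \<comment> \<open>an even index that is at least 1 is at least 2, so the two index sets agree\<close>
  have ge2: "1 \<le> n \<and> even n \<longleftrightarrow> 2 \<le> n \<and> even n" for n :: nat by auto
  have idx: "{n\<in>{1..j}. even (n + 0)} = {n\<in>{2..j}. even n}" for j :: nat using ge2 by auto
  have "(\<lambda>x. F x - (\<Sum>n=0..N. \<alpha> n * wave_trace f 0 n x)) \<in> o[at 0 within {0..b}](\<lambda>x. of_real x ^ N)"
  proof (rule wave_trace_expansion[OF assms(1-7)])
    fix j n :: nat assume "j < N" "1 \<le> n" "n \<le> j" "even (n + 0)"
    then show "regular_for q f b (j - n)" using reg ge2[of n] by simp
  next
    fix j assume "j < N"
    then show "\<alpha> (Suc j) = gamma1 f b ((gamma21 q b ^^ j) F) 0 +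
       (\<Sum>n\<in>{n\<in>{1..j}. even (n + 0)}. \<alpha> n * gamma1 f b ((gamma21 q b ^^ (j - n)) (\<lambda>_. 1)) 0)"
      unfolding idx using \<alpha>(2) by simp
  qed (simp add: \<alpha>(1))
  then show "(\<lambda>x. F x - (\<Sum>n=0..N. \<alpha> n * (c_fun f n x / fact n)))
        \<in> o[at 0 within {0..b}](\<lambda>x. of_real x ^ N)" by (simp only: wave_trace_eq)
next
  assume F0: "F 0 = 0"
    and reg: "\<forall>j<N. \<forall>n\<in>{1..j}. odd n \<longrightarrow> regular_for q f b (j - n)"
    and \<beta>: "\<forall>j<N. \<beta> (j + 1) =
         gamma1 f b ((gamma21 q b ^^ j) F) 0 +
         (\<Sum>n\<in>{n\<in>{1..j}. odd n}.
            \<beta> n * gamma1 f b ((gamma21 q b ^^ (j - n)) (\<lambda>_. 1)) 0)"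
  have "(\<lambda>x. F x - (\<Sum>n=0..N. \<beta> n * wave_trace f 1 n x)) \<in> o[at 0 within {0..b}](\<lambda>x. of_real x ^ N)"
  proof (rule wave_trace_expansion[OF assms(1-7)])
    fix j n :: nat assume "j < N" "1 \<le> n" "n \<le> j" "even (n + 1)"
    then show "regular_for q f b (j - n)" using reg by simp
  next
    fix j assume "j < N"
    then show "\<beta> (Suc j) = gamma1 f b ((gamma21 q b ^^ j) F) 0 +
       (\<Sum>n\<in>{n\<in>{1..j}. even (n + 1)}. \<beta> n * gamma1 f b ((gamma21 q b ^^ (j - n)) (\<lambda>_. 1)) 0)"
      using \<beta> by simp
  qed (simp add: F0)
  moreover have "(\<Sum>n=0..N. \<beta> n * wave_trace f 1 n x) = (\<Sum>n=1..N. \<beta> n * (s_fun f n x / fact n))" for x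
    unfolding wave_trace_eq by (simp add: sum.atLeast_Suc_atMost[of 0 N] s_fun_0)
  ultimately show "(\<lambda>x. F x - (\<Sum>n=1..N. \<beta> n * (s_fun f n x / fact n)))
        \<in> o[at 0 within {0..b}](\<lambda>x. of_real x ^ N)" by simp
qed

end
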